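(* Let $\mathcal{E}$ be an exact category (in the sense of Quillen) that is weakly idempotent complete and has relative projective covers. Then the Heller operator $\Omega : \underline{\mathcal{E}} \to \underline{\mathcal{E}}$ maps each monomorphism of $\underline{\mathcal{E}}$ to a coretraction. In particular, $\Omega$ preserves monomorphisms.
   Context: Pure short exact sequences, pure monomorphisms and pure epimorphisms are the conflations (distinguished short exact sequences), inflations and deflations of the exact category $\mathcal{E}$. An object $P$ of $\mathcal{E}$ is relatively projective if $\mathrm{Hom}_{\mathcal{E}}(P,-)$ maps pure short exact sequences to short exact sequences of abelian groups. $\mathrm{Proj}(\mathcal{E})$ is the full subcategory of relative projectives, and $\mathcal{E}$ is assumed to have enough relative projectives: each $X$ admits a pure epimorphism $P\to X$ with $P$ relatively projective. The stable category $\underline{\mathcal{E}} := \mathcal{E}/\mathrm{Proj}(\mathcal{E})$ has the same objects as $\mathcal{E}$, and its morphisms are residue classes $[f]$ of morphisms $f$ of $\mathcal{E}$ modulo those factoring over a relatively projective object. For each object $X$ choose a pure short exact sequence $\Omega X \xrightarrow{i_X} \mathrm{P}X \xrightarrow{p_X} X$ with $\mathrm{P}X$ relatively projective. The Heller operator $\Omega:\underline{\mathcal{E}}\to\underline{\mathcal{E}}$ is given on objects by this choice; for $f:X\to Y$ choose a morphism $(f',\hat f,f)$ from the chosen sequence of $X$ to that of $Y$ and set $\Omega[f]:=[f']$. Different choices of the sequences yield isomorphic functors. A morphism $f:X\to Y$ is a coretraction if there is $g:Y\to X$ such that first $f$, then $g$ composes to $\mathrm{id}_X$. $\mathcal{E}$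 is weakly idempotent complete if every coretraction in $\mathcal{E}$ has a cokernel (equivalently, every retraction has a kernel). A pure square is a commutative square $A\to T\xrightarrow{t} M$, $A\to S\xrightarrow{i} M$ that is bicartesian and whose diagonal sequence $A\to S\oplus T\to M$ is pure short exact. A morphism $i:S\to M$ is small if in each pure square of this form (with $i$ as one of the two morphisms into $M$), the morphism $t:T\to M$ is a pure epimorphism; equivalently, for each $t:T\to M$, if the morphism $S\oplus T\to M$ with components $i$ and $t$ is a pure epimorphism, then $t$ is a pure epimorphism. A relative projective cover of $X$ is a pure epimorphism $p:P\to X$ such that $P$ is relatively projective and the kernel $\mathrm{Kern}\,p\to P$ is small. $\mathcal{E}$ has relative projective covers if each object of $\mathcal{E}$ has a relative projective cover. *)

theory Defs
  imports "HOL-Algebra.Exact_Sequence"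
begin

section \<open>Categories\<close>

text \<open>
  A category is a record in the style of \<^theory>\<open>HOL-Algebra.Group\<close>. Composition is written in
  diagrammatic order: \<open>f \<cdot> g\<close> is first \<open>f\<close>, then \<open>g\<close>.
\<close>

record ('o, 'm) cat =
  Ob :: "'o set"
  Arr :: "'m set"
  Dom :: "'m \<Rightarrow> 'o"
  Cod :: "'m \<Rightarrow> 'o"
  Ident :: "'o \<Rightarrow> 'm"
  Comp :: "'m \<Rightarrow> 'm \<Rightarrow> 'm"  (infixl \<open>\<cdot>\<index>\<close> 70)

definition Hom :: "('o, 'm, 'z) cat_scheme \<Rightarrow> 'o \<Rightarrow> 'o \<Rightarrow> 'm set" where
  "Hom C X Y = {f \<in> Arr C. Dom C f = X \<and> Cod C f = Y}"

locale category =
  fixes C :: "('o, 'm, 'z) cat_scheme" (structure)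
  assumes Dom_in_Ob: "f \<in> Arr C \<Longrightarrow> Dom C f \<in> Ob C"
    and Cod_in_Ob: "f \<in> Arr C \<Longrightarrow> Cod C f \<in> Ob C"
    and Ident_in_Hom: "X \<in> Ob C \<Longrightarrow> Ident C X \<in> Hom C X X"
    and Comp_in_Hom: "\<lbrakk>f \<in> Hom C X Y; g \<in> Hom C Y Z\<rbrakk> \<Longrightarrow> f \<cdot> g \<in> Hom C X Z"
    and Ident_Comp: "f \<in> Hom C X Y \<Longrightarrow> Ident C X \<cdot> f = f"
    and Comp_Ident: "f \<in> Hom C X Y \<Longrightarrow> f \<cdot> Ident C Y = f"
    and Comp_assoc:
      "\<lbrakk>f \<in> Hom C W X; g \<in> Hom C X Y; h \<in> Hom C Y Z\<rbrakk> \<Longrightarrow> (f \<cdot> g) \<cdot> h = f \<cdot> (g \<cdot> h)"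

definition monomorphism :: "('o, 'm, 'z) cat_scheme \<Rightarrow> 'm \<Rightarrow> bool" where
  "monomorphism C f \<longleftrightarrow> f \<in> Arr C \<and>
     (\<forall>T. \<forall>g \<in> Hom C T (Dom C f). \<forall>h \<in> Hom C T (Dom C f). g \<cdot>\<^bsub>C\<^esub> f = h \<cdot>\<^bsub>C\<^esub> f \<longrightarrow> g = h)"

definition coretraction :: "('o, 'm, 'z) cat_scheme \<Rightarrow> 'm \<Rightarrow> bool" where
  "coretraction C f \<longleftrightarrow> f \<in> Arr C \<and>
     (\<exists>g \<in> Hom C (Cod C f) (Dom C f). f \<cdot>\<^bsub>C\<^esub> g = Ident C (Dom C f))"

definition isomorphism :: "('o, 'm, 'z) cat_scheme \<Rightarrow> 'm \<Rightarrow> bool" where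
  "isomorphism C f \<longleftrightarrow> f \<in> Arr C \<and>
     (\<exists>g \<in> Hom C (Cod C f) (Dom C f).
        f \<cdot>\<^bsub>C\<^esub> g = Ident C (Dom C f) \<and> g \<cdot>\<^bsub>C\<^esub> f = Ident C (Cod C f))"

text \<open>In the following three definitions, \<open>a : A \<rightarrow> S\<close>, \<open>b : A \<rightarrow> T\<close>, \<open>s : S \<rightarrow> M\<close>, \<open>t : T \<rightarrow> M\<close>.\<close>

definition commutative_square ::
    "('o, 'm, 'z) cat_scheme \<Rightarrow> 'm \<Rightarrow> 'm \<Rightarrow> 'm \<Rightarrow> 'm \<Rightarrow> bool" where
  "commutative_square C a b s t \<longleftrightarrow>
     (\<exists>A S T M. a \<in> Hom C A S \<and> b \<in> Hom C A T \<and> s \<in> Hom C S M \<and> t \<in> Hom C T M) \<and>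
     a \<cdot>\<^bsub>C\<^esub> s = b \<cdot>\<^bsub>C\<^esub> t"

definition pullback_square ::
    "('o, 'm, 'z) cat_scheme \<Rightarrow> 'm \<Rightarrow> 'm \<Rightarrow> 'm \<Rightarrow> 'm \<Rightarrow> bool" where
  "pullback_square C a b s t \<longleftrightarrow> commutative_square C a b s t \<and>
     (\<forall>a' b'. commutative_square C a' b' s t \<longrightarrow>
        (\<exists>!u. u \<in> Hom C (Dom C a') (Dom C a) \<and> u \<cdot>\<^bsub>C\<^esub> a = a' \<and> u \<cdot>\<^bsub>C\<^esub> b = b'))"

definition pushout_square ::
    "('o, 'm, 'z) cat_scheme \<Rightarrow> 'm \<Rightarrow> 'm \<Rightarrow> 'm \<Rightarrow> 'm \<Rightarrow> bool" where
  "pushout_square C a b s t \<longleftrightarrow> commutative_square C a b s t \<and>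
     (\<forall>s' t'. commutative_square C a b s' t' \<longrightarrow>
        (\<exists>!u. u \<in> Hom C (Cod C s) (Cod C s') \<and> s \<cdot>\<^bsub>C\<^esub> u = s' \<and> t \<cdot>\<^bsub>C\<^esub> u = t'))"


section \<open>Additive categories\<close>

record ('o, 'm) precat = "('o, 'm) cat" +
  Add :: "'m \<Rightarrow> 'm \<Rightarrow> 'm"
  Zero :: "'o \<Rightarrow> 'o \<Rightarrow> 'm"

definition hom_group :: "('o, 'm, 'z) precat_scheme \<Rightarrow> 'o \<Rightarrow> 'o \<Rightarrow> 'm monoid" where
  "hom_group E X Y = \<lparr>carrier = Hom E X Y, monoid.mult = Add E, one = Zero E X Y\<rparr>"

locale preadditive_category = category E
  for E :: "('o, 'm, 'z) precat_scheme" (structure) +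
  assumes comm_group_hom_group: "\<lbrakk>X \<in> Ob E; Y \<in> Ob E\<rbrakk> \<Longrightarrow> comm_group (hom_group E X Y)"
    and Comp_Add_left: "\<lbrakk>f \<in> Hom E X Y; g \<in> Hom E X Y; h \<in> Hom E Y Z\<rbrakk> \<Longrightarrow>
      Add E f g \<cdot> h = Add E (f \<cdot> h) (g \<cdot> h)"
    and Comp_Add_right: "\<lbrakk>f \<in> Hom E X Y; g \<in> Hom E Y Z; h \<in> Hom E Y Z\<rbrakk> \<Longrightarrow>
      f \<cdot> Add E g h = Add E (f \<cdot> g) (f \<cdot> h)"

definition zero_object :: "('o, 'm, 'z) cat_scheme \<Rightarrow> 'o \<Rightarrow> bool" where
  "zero_object E N \<longleftrightarrow> N \<in> Ob E \<and>
     (\<forall>X \<in> Ob E. (\<exists>!f. f \<in> Hom E X N) \<and> (\<exists>!f. f \<in> Hom E N X))"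

text \<open>\<open>D\<close> is a direct sum of \<open>X\<close> and \<open>Y\<close>, with inclusions \<open>j1\<close>, \<open>j2\<close> and projections \<open>q1\<close>, \<open>q2\<close>.\<close>

definition direct_sum :: "('o, 'm, 'z) precat_scheme \<Rightarrow> 'o \<Rightarrow> 'o \<Rightarrow> 'o \<Rightarrow>
    'm \<Rightarrow> 'm \<Rightarrow> 'm \<Rightarrow> 'm \<Rightarrow> bool" where
  "direct_sum E X Y D j1 j2 q1 q2 \<longleftrightarrow>
     X \<in> Ob E \<and> Y \<in> Ob E \<and> D \<in> Ob E \<and>
     j1 \<in> Hom E X D \<and> j2 \<in> Hom E Y D \<and> q1 \<in> Hom E D X \<and> q2 \<in> Hom E D Y \<and>
     j1 \<cdot>\<^bsub>E\<^esub> q1 = Ident E X \<and> j2 \<cdot>\<^bsub>E\<^esub> q2 = Ident E Y \<and>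
     j1 \<cdot>\<^bsub>E\<^esub> q2 = Zero E X Y \<and> j2 \<cdot>\<^bsub>E\<^esub> q1 = Zero E Y X \<and>
     Add E (q1 \<cdot>\<^bsub>E\<^esub> j1) (q2 \<cdot>\<^bsub>E\<^esub> j2) = Ident E D"

locale additive_category = preadditive_category E
  for E :: "('o, 'm, 'z) precat_scheme" (structure) +
  assumes ex_zero_object: "\<exists>N. zero_object E N"
    and ex_direct_sum: "\<lbrakk>X \<in> Ob E; Y \<in> Ob E\<rbrakk> \<Longrightarrow> \<exists>D j1 j2 q1 q2. direct_sum E X Y D j1 j2 q1 q2"

definition is_kernel :: "('o, 'm, 'z) precat_scheme \<Rightarrow> 'm \<Rightarrow> 'm \<Rightarrow> bool" where
  "is_kernel E i p \<longleftrightarrow> i \<in> Arr E \<and> p \<in> Arr E \<and> Cod E i = Dom E p \<and>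
     i \<cdot>\<^bsub>E\<^esub> p = Zero E (Dom E i) (Cod E p) \<and>
     (\<forall>T. \<forall>h \<in> Hom E T (Dom E p). h \<cdot>\<^bsub>E\<^esub> p = Zero E T (Cod E p) \<longrightarrow>
        (\<exists>!u. u \<in> Hom E T (Dom E i) \<and> u \<cdot>\<^bsub>E\<^esub> i = h))"

definition is_cokernel :: "('o, 'm, 'z) precat_scheme \<Rightarrow> 'm \<Rightarrow> 'm \<Rightarrow> bool" where
  "is_cokernel E p i \<longleftrightarrow> i \<in> Arr E \<and> p \<in> Arr E \<and> Cod E i = Dom E p \<and>
     i \<cdot>\<^bsub>E\<^esub> p = Zero E (Dom E i) (Cod E p) \<and>
     (\<forall>T. \<forall>h \<in> Hom E (Cod E i) T. i \<cdot>\<^bsub>E\<^esub> h = Zero E (Dom E i) T \<longrightarrow>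
        (\<exists>!u. u \<in> Hom E (Cod E p) T \<and> p \<cdot>\<^bsub>E\<^esub> u = h))"

definition weakly_idempotent_complete :: "('o, 'm, 'z) precat_scheme \<Rightarrow> bool" where
  "weakly_idempotent_complete E \<longleftrightarrow> (\<forall>f. coretraction E f \<longrightarrow> (\<exists>c. is_cokernel E c f))"


section \<open>Exact categories\<close>

text \<open>\<open>(i, p) \<in> Pure E\<close> means that \<open>i\<close> followed by \<open>p\<close> is a pure short exact sequence.\<close>

record ('o, 'm) excat = "('o, 'm) precat" +
  Pure :: "('m \<times> 'm) set"

definition pure_mono :: "('o, 'm, 'z) excat_scheme \<Rightarrow> 'm \<Rightarrow> bool" where
  "pure_mono E i \<longleftrightarrow> (\<exists>p. (i, p) \<in> Pure E)"

definition pure_epi :: "('o, 'm, 'z) excat_scheme \<Rightarrow> 'm \<Rightarrow> bool" where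
  "pure_epi E p \<longleftrightarrow> (\<exists>i. (i, p) \<in> Pure E)"

text \<open>
  Quillen's axioms, without the condition that a morphism having a kernel is a deflation as soon as
  some composite ending in it is one (and its dual), which Keller showed to be redundant.
\<close>

locale exact_category = additive_category E
  for E :: "('o, 'm, 'z) excat_scheme" (structure) +
  assumes pure_kernel: "(i, p) \<in> Pure E \<Longrightarrow> is_kernel E i p"
    and pure_cokernel: "(i, p) \<in> Pure E \<Longrightarrow> is_cokernel E p i"
    and pure_iso_closed: "\<lbrakk>(i, p) \<in> Pure E; i' \<in> Hom E X' Y'; p' \<in> Hom E Y' Z';
        isomorphism E \<alpha>; isomorphism E \<beta>; isomorphism E \<gamma>;
        \<alpha> \<in> Hom E (Dom E i) X'; \<beta> \<in> Hom E (Dom E p) Y'; \<gamma> \<in> Hom E (Cod E p) Z';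
        i \<cdot> \<beta> = \<alpha> \<cdot> i'; p \<cdot> \<gamma> = \<beta> \<cdot> p'\<rbrakk> \<Longrightarrow> (i', p') \<in> Pure E"
    and pure_split: "direct_sum E X Y D j1 j2 q1 q2 \<Longrightarrow> (j1, q2) \<in> Pure E"
    and pure_mono_Comp: "\<lbrakk>pure_mono E f; pure_mono E g; Cod E f = Dom E g\<rbrakk> \<Longrightarrow> pure_mono E (f \<cdot> g)"
    and pure_epi_Comp: "\<lbrakk>pure_epi E f; pure_epi E g; Cod E f = Dom E g\<rbrakk> \<Longrightarrow> pure_epi E (f \<cdot> g)"
    and pure_mono_pushout: "\<lbrakk>pure_mono E i; f \<in> Arr E; Dom E f = Dom E i\<rbrakk> \<Longrightarrow>
        \<exists>f' i'. pushout_square E i f f' i' \<and> pure_mono E i'"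
    and pure_epi_pullback: "\<lbrakk>pure_epi E p; f \<in> Arr E; Cod E f = Cod E p\<rbrakk> \<Longrightarrow>
        \<exists>f' p'. pullback_square E f' p' p f \<and> pure_epi E p'"

definition pure_square :: "('o, 'm, 'z) excat_scheme \<Rightarrow> 'm \<Rightarrow> 'm \<Rightarrow> 'm \<Rightarrow> 'm \<Rightarrow> bool" where
  "pure_square E a b s t \<longleftrightarrow> pullback_square E a b s t \<and> pushout_square E a b s t \<and>
     (\<exists>D j1 j2 q1 q2. direct_sum E (Dom E s) (Dom E t) D j1 j2 q1 q2 \<and>
        (Add E (a \<cdot>\<^bsub>E\<^esub> j1) (inv\<^bsub>hom_group E (Dom E b) D\<^esub> (b \<cdot>\<^bsub>E\<^esub> j2)),
         Add E (q1 \<cdot>\<^bsub>E\<^esub> s) (q2 \<cdot>\<^bsub>E\<^esub> t)) \<in> Pure E)"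

definition small :: "('o, 'm, 'z) excat_scheme \<Rightarrow> 'm \<Rightarrow> bool" where
  "small E i \<longleftrightarrow> i \<in> Arr E \<and> (\<forall>a b t. pure_square E a b i t \<longrightarrow> pure_epi E t)"

text \<open>\<^const>\<open>short_exact_sequence\<close> lists the groups and maps of a sequence from right to left.\<close>

definition rel_projective :: "('o, 'm, 'z) excat_scheme \<Rightarrow> 'o \<Rightarrow> bool" where
  "rel_projective E P \<longleftrightarrow> P \<in> Ob E \<and>
     (\<forall>(i, p) \<in> Pure E. short_exact_sequence
        (hom_group E P (Cod E p)) (hom_group E P (Dom E p)) (hom_group E P (Dom E i))
        (\<lambda>h. h \<cdot>\<^bsub>E\<^esub> p) (\<lambda>h. h \<cdot>\<^bsub>E\<^esub> i))"

definition rel_projective_cover :: "('o, 'm, 'z) excat_scheme \<Rightarrow> 'o \<Rightarrow> 'm \<Rightarrow> bool" where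
  "rel_projective_cover E X p \<longleftrightarrow> pure_epi E p \<and> Cod E p = X \<and> rel_projective E (Dom E p) \<and>
     (\<exists>k. is_kernel E k p \<and> small E k)"

definition has_rel_projective_covers :: "('o, 'm, 'z) excat_scheme \<Rightarrow> bool" where
  "has_rel_projective_covers E \<longleftrightarrow> (\<forall>X \<in> Ob E. \<exists>p. rel_projective_cover E X p)"


section \<open>The stable category\<close>

definition null_homs :: "('o, 'm, 'z) excat_scheme \<Rightarrow> 'o \<Rightarrow> 'o \<Rightarrow> 'm set" where
  "null_homs E X Y =
     {a \<cdot>\<^bsub>E\<^esub> b | a b P. rel_projective E P \<and> a \<in> Hom E X P \<and> b \<in> Hom E P Y}"

definition stable_class :: "('o, 'm, 'z) excat_scheme \<Rightarrow> 'm \<Rightarrow> 'm set" where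
  "stable_class E f =
     null_homs E (Dom E f) (Cod E f) #>\<^bsub>hom_group E (Dom E f) (Cod E f)\<^esub> f"

definition rep :: "'m set \<Rightarrow> 'm" where
  "rep \<phi> = (SOME f. f \<in> \<phi>)"

definition stable_category :: "('o, 'm, 'z) excat_scheme \<Rightarrow> ('o, 'm set) cat" where
  "stable_category E =
     \<lparr>Ob = Ob E,
      Arr = stable_class E ` Arr E,
      Dom = (\<lambda>\<phi>. Dom E (rep \<phi>)),
      Cod = (\<lambda>\<phi>. Cod E (rep \<phi>)),
      Ident = (\<lambda>X. stable_class E (Ident E X)),
      Comp = (\<lambda>\<phi> \<psi>. stable_class E (rep \<phi> \<cdot>\<^bsub>E\<^esub> rep \<psi>))\<rparr>"


section \<open>The Heller operator\<close>

text \<open>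
  \<open>i X\<close> followed by \<open>p X\<close> is the chosen sequence of \<open>X\<close>; hence \<open>\<Omega> X = Dom E (i X)\<close> and
  \<open>P X = Dom E (p X)\<close>.
\<close>

definition heller_choice :: "('o, 'm, 'z) excat_scheme \<Rightarrow> ('o \<Rightarrow> 'm) \<Rightarrow> ('o \<Rightarrow> 'm) \<Rightarrow> bool" where
  "heller_choice E i p \<longleftrightarrow>
     (\<forall>X \<in> Ob E. (i X, p X) \<in> Pure E \<and> Cod E (p X) = X \<and> rel_projective E (Dom E (p X)))"

definition heller_lift :: "('o, 'm, 'z) excat_scheme \<Rightarrow> ('o \<Rightarrow> 'm) \<Rightarrow> ('o \<Rightarrow> 'm) \<Rightarrow>
    'm \<Rightarrow> 'm \<Rightarrow> 'm \<Rightarrow> bool" where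
  "heller_lift E i p f' fh f \<longleftrightarrow>
     (let X = Dom E f; Y = Cod E f in
        f' \<in> Hom E (Dom E (i X)) (Dom E (i Y)) \<and> fh \<in> Hom E (Dom E (p X)) (Dom E (p Y)) \<and>
        f' \<cdot>\<^bsub>E\<^esub> i Y = i X \<cdot>\<^bsub>E\<^esub> fh \<and> fh \<cdot>\<^bsub>E\<^esub> p Y = p X \<cdot>\<^bsub>E\<^esub> f)"

definition heller :: "('o, 'm, 'z) excat_scheme \<Rightarrow> ('o \<Rightarrow> 'm) \<Rightarrow> ('o \<Rightarrow> 'm) \<Rightarrow> 'm set \<Rightarrow> 'm set" where
  "heller E i p \<phi> = stable_class E (SOME f'. \<exists>fh. heller_lift E i p f' fh (rep \<phi>))"

end

(*
  Choose pure short exact sequences with maps i X, p X, and let f : X \<rightarrow> Y be stably monic. The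
  pullback K of f and p Y comes with k : K \<rightarrow> X and b : K \<rightarrow> P Y with k \<cdot> f = b \<cdot> p Y. So k \<cdot> f is
  stably zero, hence so is k, i.e. k = v \<cdot> p X for some v : K \<rightarrow> P X. The lift of f induces
  u : P X \<rightarrow> K with u \<cdot> k = p X, and therefore u \<cdot> v = 1 + s \<cdot> i X for some s. Restricted to the
  kernels, u and v become f' : \<Omega>X \<rightarrow> \<Omega>Y and some w : \<Omega>Y \<rightarrow> \<Omega>X, and f' \<cdot> w = i X \<cdot> s + 1 is stably
  the identity.
*)
theory Submission
  imports Defs
begin

section \<open>Coretractions in a category\<close>

lemma (in category) Hom_in_Ob:
  assumes "f \<in> Hom C X Y"
  shows "X \<in> Ob C" "Y \<in> Ob C"
  using assms Dom_in_Ob Cod_in_Ob by (auto simp: Hom_def)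

text \<open>Composing with a retraction \<open>r\<close> recovers \<open>g\<close> from
  \<open>g \<cdot> f\<close>. Applied to the stable category, this deduces preservation of
  monomorphisms from the coretraction statement.\<close>

lemma (in category) coretraction_imp_monomorphism:
  assumes "coretraction C f"
  shows "monomorphism C f"
proof -
  from assms obtain r where f: "f \<in> Hom C (Dom C f) (Cod C f)"
    and r: "r \<in> Hom C (Cod C f) (Dom C f)" "f \<cdot> r = Ident C (Dom C f)"
    by (auto simp: coretraction_def Hom_def)
  have "g \<cdot> f \<cdot> r = g" if "g \<in> Hom C T (Dom C f)" for g T
    using Comp_assoc[OF that f r(1)] Comp_Ident[OF that] r(2) by simp
  then show ?thesis
    using f unfolding monomorphism_def by (metis (mono_tags, lifting) Hom_def mem_Collect_eq)
qed

section \<open>Hom groups, zero morphisms and kernels\<close>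

lemma hom_group_simps [simp]:
  "carrier (hom_group E X Y) = Hom E X Y"
  "monoid.mult (hom_group E X Y) = Add E"
  "one (hom_group E X Y) = Zero E X Y"
  by (simp_all add: hom_group_def)

context preadditive_category
begin

text \<open>Linearity of composition in one argument, phrased as a homomorphism of hom groups. In
  this form, here and in \<open>group_hom_Comp_right\<close>, library facts on units, inverses and
  images apply to composition.\<close>

lemma group_hom_Comp_left:
  assumes "f \<in> Hom E X Y" "Z \<in> Ob E"
  shows "group_hom (hom_group E Y Z) (hom_group E X Z) (\<lambda>g. f \<cdot> g)"
  using assms Hom_in_Ob[OF assms(1)] comm_group_hom_group Comp_in_Hom Comp_Add_right
  by (auto simp: group_hom_def group_hom_axioms_def hom_def comm_group_def Pi_def)

lemma group_hom_Comp_right: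
  assumes "g \<in> Hom E Y Z" "X \<in> Ob E"
  shows "group_hom (hom_group E X Y) (hom_group E X Z) (\<lambda>f. f \<cdot> g)"
  using assms Hom_in_Ob[OF assms(1)] comm_group_hom_group Comp_in_Hom Comp_Add_left
  by (auto simp: group_hom_def group_hom_axioms_def hom_def comm_group_def Pi_def)

lemma Comp_Zero: "\<lbrakk>f \<in> Hom E X Y; Z \<in> Ob E\<rbrakk> \<Longrightarrow> f \<cdot> Zero E Y Z = Zero E X Z"
  using group_hom.hom_one[OF group_hom_Comp_left] by simp

lemma Zero_Comp: "\<lbrakk>g \<in> Hom E Y Z; X \<in> Ob E\<rbrakk> \<Longrightarrow> Zero E X Y \<cdot> g = Zero E X Z"
  using group_hom.hom_one[OF group_hom_Comp_right] by simp

lemma group_hom_group: "\<lbrakk>X \<in> Ob E; Y \<in> Ob E\<rbrakk> \<Longrightarrow> group (hom_group E X Y)"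
  using comm_group_hom_group by (simp add: comm_group_def)

lemma Zero_in_Hom: "\<lbrakk>X \<in> Ob E; Y \<in> Ob E\<rbrakk> \<Longrightarrow> Zero E X Y \<in> Hom E X Y"
  using monoid.one_closed[OF group.is_monoid[OF group_hom_group]] by simp

lemma Add_in_Hom: "\<lbrakk>f \<in> Hom E X Y; g \<in> Hom E X Y\<rbrakk> \<Longrightarrow> Add E f g \<in> Hom E X Y"
  using monoid.m_closed[OF group.is_monoid[OF group_hom_group]] Hom_in_Ob by fastforce

lemma kernel_factor:
  assumes "is_kernel E k q" "h \<in> Hom E T (Dom E q)" "h \<cdot> q = Zero E T (Cod E q)"
  obtains u where "u \<in> Hom E T (Dom E k)" "u \<cdot> k = h"
  using assms unfolding is_kernel_def by blast

text \<open>The morphism \<open>g \<cdot> k\<close> is annihilated by \<open>q\<close>, and both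
  \<open>g\<close> and \<open>h\<close> factor it through \<open>k\<close>; the factorization is
  unique.\<close>

lemma kernel_cancel:
  assumes k: "is_kernel E k q" and g: "g \<in> Hom E T (Dom E k)" and h: "h \<in> Hom E T (Dom E k)"
    and eq: "g \<cdot> k = h \<cdot> k"
  shows "g = h"
proof -
  have kH: "k \<in> Hom E (Dom E k) (Dom E q)" and qH: "q \<in> Hom E (Dom E q) (Cod E q)"
    and z: "k \<cdot> q = Zero E (Dom E k) (Cod E q)"
    using k by (auto simp: is_kernel_def Hom_def)
  have "g \<cdot> k \<in> Hom E T (Dom E q)" "g \<cdot> k \<cdot> q = Zero E T (Cod E q)"
    using Comp_in_Hom[OF g kH] Comp_assoc[OF g kH qH] Comp_Zero[OF g] z Hom_in_Ob[OF qH]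
    by simp_all
  then have "\<exists>!u. u \<in> Hom E T (Dom E k) \<and> u \<cdot> k = g \<cdot> k"
    using k by (auto simp: is_kernel_def)
  with g h eq show ?thesis by auto
qed

text \<open>The difference \<open>d\<close> of \<open>g\<close> and \<open>h\<close> is annihilated
  by \<open>q\<close>, so it factors through the kernel as \<open>s \<cdot> k\<close>.\<close>

lemma comp_eq_imp_eq_Add_kernel:
  assumes k: "is_kernel E k q" and g: "g \<in> Hom E T (Dom E q)" and h: "h \<in> Hom E T (Dom E q)"
    and eq: "g \<cdot> q = h \<cdot> q"
  obtains s where "s \<in> Hom E T (Dom E k)" "g = Add E (s \<cdot> k) h"
proof -
  have qH: "q \<in> Hom E (Dom E q) (Cod E q)" using k by (auto simp: is_kernel_def Hom_def)
  have T: "T \<in> Ob E" and D: "Dom E q \<in> Ob E" using g Hom_in_Ob by auto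
  interpret q: group_hom "hom_group E T (Dom E q)" "hom_group E T (Cod E q)" "\<lambda>f. f \<cdot> q"
    using group_hom_Comp_right[OF qH T] .
  define d where "d = Add E g (inv\<^bsub>hom_group E T (Dom E q)\<^esub> h)"
  have d: "d \<in> Hom E T (Dom E q)"
    unfolding d_def using q.G.m_closed[of g "inv\<^bsub>hom_group E T (Dom E q)\<^esub> h"] q.G.inv_closed[of h] g h
    by simp
  have "d \<cdot> q = Zero E T (Cod E q)"
    using q.hom_mult[of g "inv\<^bsub>hom_group E T (Dom E q)\<^esub> h"] q.hom_inv[of h] q.G.inv_closed[of h]
      q.H.r_inv[of "h \<cdot> q"] Comp_in_Hom[OF h qH] g h eq
    by (simp add: d_def)
  from kernel_factor[OF k d this] obtain s where s: "s \<in> Hom E T (Dom E k)" "s \<cdot> k = d" .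
  have "Add E d h = g"
    using q.G.m_assoc[of g "inv\<^bsub>hom_group E T (Dom E q)\<^esub> h" h] q.G.inv_closed[of h]
      q.G.l_inv[of h] q.G.r_one[of g] g h
    by (simp add: d_def)
  with s that show thesis by metis
qed

end

section \<open>Pullback squares and lifting along pure epimorphisms\<close>

lemma pullback_squareE:
  assumes "pullback_square E a b s t" "a' \<in> Hom E T (Dom E s)" "b' \<in> Hom E T (Dom E t)"
    "a' \<cdot>\<^bsub>E\<^esub> s = b' \<cdot>\<^bsub>E\<^esub> t"
  obtains u where "u \<in> Hom E T (Dom E a)" "u \<cdot>\<^bsub>E\<^esub> a = a'" "u \<cdot>\<^bsub>E\<^esub> b = b'"
proof -
  have "commutative_square E a' b' s t" "Dom E a' = T"
    using assms by (auto simp: pullback_square_def commutative_square_def Hom_def)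
  with assms that show thesis unfolding pullback_square_def by metis
qed

text \<open>The pair \<open>u \<cdot> a\<close>, \<open>u \<cdot> b\<close> is a test pair for the
  pullback, and both \<open>u\<close> and \<open>v\<close> mediate for it.\<close>

lemma pullback_square_unique:
  assumes "pullback_square E a b s t" "category E" "u \<in> Hom E T (Dom E a)" "v \<in> Hom E T (Dom E a)"
    "u \<cdot>\<^bsub>E\<^esub> a = v \<cdot>\<^bsub>E\<^esub> a" "u \<cdot>\<^bsub>E\<^esub> b = v \<cdot>\<^bsub>E\<^esub> b"
  shows "u = v"
proof -
  interpret category E by fact
  from assms(1) obtain A S R M where H: "a \<in> Hom E A S" "b \<in> Hom E A R" "s \<in> Hom E S M"
    "t \<in> Hom E R M" "a \<cdot>\<^bsub>E\<^esub> s = b \<cdot>\<^bsub>E\<^esub> t"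
    by (auto simp: pullback_square_def commutative_square_def)
  have u: "u \<in> Hom E T A" using assms(3) H by (simp add: Hom_def)
  have "commutative_square E (u \<cdot>\<^bsub>E\<^esub> a) (u \<cdot>\<^bsub>E\<^esub> b) s t" "Dom E (u \<cdot>\<^bsub>E\<^esub> a) = T"
    using Comp_in_Hom[OF u H(1)] Comp_in_Hom[OF u H(2)] Comp_assoc[OF u H(1,3)]
      Comp_assoc[OF u H(2,4)] H
    by (auto simp: commutative_square_def Hom_def)
  then have "\<exists>!x. x \<in> Hom E T (Dom E a) \<and> x \<cdot>\<^bsub>E\<^esub> a = u \<cdot>\<^bsub>E\<^esub> a \<and> x \<cdot>\<^bsub>E\<^esub> b = u \<cdot>\<^bsub>E\<^esub> b"
    using assms(1) unfolding pullback_square_def by metis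
  with assms show ?thesis by auto
qed

text \<open>The right end of the short exact sequence of hom groups says that composition with
  \<open>q\<close> is onto, which is the lifting property.\<close>

lemma rel_projective_lift:
  assumes "rel_projective E P" "pure_epi E q" "h \<in> Hom E P (Cod E q)"
  obtains g where "g \<in> Hom E P (Dom E q)" "g \<cdot>\<^bsub>E\<^esub> q = h"
proof -
  from assms(2) obtain k where "(k, q) \<in> Pure E" by (auto simp: pure_epi_def)
  with assms(1) have "short_exact_sequence
        (hom_group E P (Cod E q)) (hom_group E P (Dom E q)) (hom_group E P (Dom E k))
        (\<lambda>h. h \<cdot>\<^bsub>E\<^esub> q) (\<lambda>h. h \<cdot>\<^bsub>E\<^esub> k)"
    by (auto simp: rel_projective_def)
  from short_exact_sequenceD[OF this]
  have "(\<lambda>h. h \<cdot>\<^bsub>E\<^esub> q) ` Hom E P (Dom E q) = Hom E P (Cod E q)"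
    by (simp add: epi_def)
  with assms(3) that show thesis by (metis imageE)
qed

section \<open>The chosen sequences and the ideal of null morphisms\<close>

locale exact_category_heller = exact_category E
  for E :: "('o, 'm, 'z) excat_scheme" (structure) +
  fixes i p :: "'o \<Rightarrow> 'm"
  assumes heller_choice: "heller_choice E i p"
begin

lemma chosen:
  assumes "X \<in> Ob E"
  shows chosen_kernel: "is_kernel E (i X) (p X)"
    and chosen_pure_epi: "pure_epi E (p X)"
    and chosen_i: "i X \<in> Hom E (Dom E (i X)) (Dom E (p X))"
    and chosen_p: "p X \<in> Hom E (Dom E (p X)) X"
    and chosen_rel_projective: "rel_projective E (Dom E (p X))"
    and chosen_i_p: "i X \<cdot> p X = Zero E (Dom E (i X)) X"
proof -
  have *: "(i X, p X) \<in> Pure E" "Cod E (p X) = X" "rel_projective E (Dom E (p X))"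
    using heller_choice assms by (auto simp: heller_choice_def)
  show k: "is_kernel E (i X) (p X)" using *(1) by (rule pure_kernel)
  show "pure_epi E (p X)" "rel_projective E (Dom E (p X))" using * by (auto simp: pure_epi_def)
  show "i X \<in> Hom E (Dom E (i X)) (Dom E (p X))" "p X \<in> Hom E (Dom E (p X)) X"
    "i X \<cdot> p X = Zero E (Dom E (i X)) X"
    using k * by (auto simp: is_kernel_def Hom_def)
qed

text \<open>A morphism \<open>b\<close> from a relative projective to \<open>Y\<close> lifts along
  the pure epimorphism \<open>p Y\<close>. Hence the varying relative projective can be replaced by
  the single object \<open>Dom E (p Y)\<close>.\<close>

lemma null_homs_eq:
  assumes "X \<in> Ob E" "Y \<in> Ob E"
  shows "null_homs E X Y = (\<lambda>a. a \<cdot> p Y) ` Hom E X (Dom E (p Y))"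
proof (intro equalityI subsetI)
  fix h assume "h \<in> null_homs E X Y"
  then obtain a b P where h: "h = a \<cdot> b" and P: "rel_projective E P"
    and a: "a \<in> Hom E X P" and b: "b \<in> Hom E P Y"
    by (auto simp: null_homs_def)
  note pY = chosen_p[OF assms(2)]
  have "Cod E (p Y) = Y" using pY by (simp add: Hom_def)
  with b P obtain c where c: "c \<in> Hom E P (Dom E (p Y))" "c \<cdot> p Y = b"
    using rel_projective_lift[OF P chosen_pure_epi[OF assms(2)]] by metis
  then have "h = (a \<cdot> c) \<cdot> p Y" using Comp_assoc[OF a c(1) pY] h by simp
  then show "h \<in> (\<lambda>a. a \<cdot> p Y) ` Hom E X (Dom E (p Y))" using Comp_in_Hom[OF a c(1)] by blast
next
  fix h assume "h \<in> (\<lambda>a. a \<cdot> p Y) ` Hom E X (Dom E (p Y))"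
  then show "h \<in> null_homs E X Y"
    unfolding null_homs_def using chosen_p[OF assms(2)] chosen_rel_projective[OF assms(2)] by auto
qed

text \<open>By \<open>null_homs_eq\<close> this is the image of composition with \<open>p Y\<close>,
  so closure under addition requires no direct sums of relative projectives.\<close>

lemma subgroup_null_homs:
  assumes "X \<in> Ob E" "Y \<in> Ob E"
  shows "subgroup (null_homs E X Y) (hom_group E X Y)"
  using group_hom.img_is_subgroup[OF group_hom_Comp_right[OF chosen_p[OF assms(2)] assms(1)]]
  by (simp add: null_homs_eq[OF assms])

text \<open>With \<open>null_homs_Comp_right\<close> this makes the null morphisms a two-sided
  ideal, so that composition of residue classes is well defined.\<close>

lemma null_homs_Comp_left:
  assumes "f \<in> Hom E X Y" "g \<in> null_homs E Y Z"
  shows "f \<cdot> g \<in> null_homs E X Z"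
proof -
  from assms(2) obtain a b P where *: "g = a \<cdot> b" "rel_projective E P" "a \<in> Hom E Y P" "b \<in> Hom E P Z"
    by (auto simp: null_homs_def)
  then show ?thesis unfolding null_homs_def
    using Comp_assoc[OF assms(1) *(3,4)] Comp_in_Hom[OF assms(1) *(3)]
    by (smt (verit) mem_Collect_eq)
qed

lemma null_homs_Comp_right:
  assumes "f \<in> null_homs E X Y" "g \<in> Hom E Y Z"
  shows "f \<cdot> g \<in> null_homs E X Z"
proof -
  from assms(1) obtain a b P where *: "f = a \<cdot> b" "rel_projective E P" "a \<in> Hom E X P" "b \<in> Hom E P Y"
    by (auto simp: null_homs_def)
  then show ?thesis unfolding null_homs_def
    using Comp_assoc[OF *(3,4) assms(2)] Comp_in_Hom[OF *(4) assms(2)]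
    by (smt (verit) mem_Collect_eq)
qed

section \<open>Residue classes and the stable category\<close>

lemma mem_stable_class_iff:
  assumes "f \<in> Hom E X Y"
  shows "g \<in> stable_class E f \<longleftrightarrow> (\<exists>n \<in> null_homs E X Y. g = Add E n f)"
  using assms by (auto simp: stable_class_def r_coset_def Hom_def)

lemma stable_class_in_Hom:
  assumes f: "f \<in> Hom E X Y" and "g \<in> stable_class E f"
  shows "g \<in> Hom E X Y"
proof -
  from assms obtain n where n: "n \<in> null_homs E X Y" "g = Add E n f"
    using mem_stable_class_iff by blast
  moreover have "n \<in> Hom E X Y"
    using n subgroup.subset[OF subgroup_null_homs[OF Hom_in_Ob[OF f]]] by auto
  ultimately show ?thesis using f by (simp add: Add_in_Hom)
qed

lemma stable_class_eq:
  assumes f: "f \<in> Hom E X Y" and g: "g \<in> stable_class E f"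
  shows "stable_class E g = stable_class E f"
  using group.repr_independence[OF group_hom_group[OF Hom_in_Ob[OF f]], of g "null_homs E X Y" f]
    subgroup_null_homs[OF Hom_in_Ob[OF f]] stable_class_in_Hom[OF f g] f g
  by (simp add: stable_class_def Hom_def)

lemma stable_class_self:
  assumes f: "f \<in> Hom E X Y"
  shows "f \<in> stable_class E f"
  using group.rcos_self[OF group_hom_group[OF Hom_in_Ob[OF f]], of f "null_homs E X Y"]
    subgroup_null_homs[OF Hom_in_Ob[OF f]] f
  by (simp add: stable_class_def Hom_def)

text \<open>Since \<open>rep\<close> is a choice by \<open>SOME\<close>, membership in the class is
  what is known of it. The facts on composition therefore speak of arbitrary members of a
  class.\<close>

lemma rep_stable_class:
  assumes "f \<in> Hom E X Y"
  shows "rep (stable_class E f) \<in> stable_class E f"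
  unfolding rep_def using stable_class_self[OF assms] by (rule someI)

text \<open>Write \<open>f' = n + f\<close> and \<open>g' = m + g\<close> with null
  \<open>n\<close>, \<open>m\<close>. Then
  \<open>f' \<cdot> g' = n \<cdot> g' + f \<cdot> m + f \<cdot> g\<close>, where the first two terms
  are null by the ideal property.\<close>

lemma stable_class_Comp:
  assumes f: "f \<in> Hom E X Y" and g: "g \<in> Hom E Y Z"
    and f': "f' \<in> stable_class E f" and g': "g' \<in> stable_class E g"
  shows "stable_class E (f' \<cdot> g') = stable_class E (f \<cdot> g)"
proof -
  from f' f obtain n where n: "n \<in> null_homs E X Y" "f' = Add E n f"
    using mem_stable_class_iff by blast
  from g' g obtain m where m: "m \<in> null_homs E Y Z" "g' = Add E m g"
    using mem_stable_class_iff by blast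
  note Ob = Hom_in_Ob[OF f] Hom_in_Ob[OF g]
  have g'H: "g' \<in> Hom E Y Z" using stable_class_in_Hom[OF g g'] .
  have nH: "n \<in> Hom E X Y" and mH: "m \<in> Hom E Y Z"
    using n m subgroup.subset[OF subgroup_null_homs] Ob by fastforce+
  note N = null_homs_Comp_right[OF n(1) g'H] null_homs_Comp_left[OF f m(1)]
  have "f' \<cdot> g' = Add E (n \<cdot> g') (Add E (f \<cdot> m) (f \<cdot> g))"
    using Comp_Add_left[OF nH f g'H] Comp_Add_right[OF f mH g] n(2) m(2) by simp
  also have "\<dots> = Add E (Add E (n \<cdot> g') (f \<cdot> m)) (f \<cdot> g)"
    using monoid.m_assoc[OF group.is_monoid[OF group_hom_group[OF Ob(1) Ob(4)]],
        of "n \<cdot> g'" "f \<cdot> m" "f \<cdot> g"]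
      Comp_in_Hom[OF nH g'H] Comp_in_Hom[OF f mH] Comp_in_Hom[OF f g]
    by simp
  finally have "f' \<cdot> g' \<in> stable_class E (f \<cdot> g)"
    using subgroup.m_closed[OF subgroup_null_homs[OF Ob(1) Ob(4)] N]
      mem_stable_class_iff[OF Comp_in_Hom[OF f g]]
    by auto
  then show ?thesis using stable_class_eq[OF Comp_in_Hom[OF f g]] by blast
qed

text \<open>Stable domain and codomain are read off from \<open>rep\<close>, and every member of the
  class has the same ends as \<open>f\<close>.\<close>

lemma stable_class_in_stable_Hom:
  assumes "f \<in> Hom E X Y"
  shows "stable_class E f \<in> Hom (stable_category E) X Y"
  using stable_class_in_Hom[OF assms rep_stable_class[OF assms]] assms
  by (auto simp: stable_category_def Hom_def)

lemma stable_HomE: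
  assumes "\<phi> \<in> Hom (stable_category E) X Y"
  obtains f where "f \<in> Hom E X Y" "\<phi> = stable_class E f"
proof -
  from assms obtain f where f: "f \<in> Arr E" "\<phi> = stable_class E f"
    by (auto simp: stable_category_def Hom_def)
  then have "f \<in> Hom E (Dom E f) (Cod E f)" by (simp add: Hom_def)
  with stable_class_in_stable_Hom[OF this] f assms that show thesis by (auto simp: Hom_def)
qed

lemma stable_Comp:
  assumes "f \<in> Hom E X Y" "g \<in> Hom E Y Z"
  shows "stable_class E f \<cdot>\<^bsub>stable_category E\<^esub> stable_class E g = stable_class E (f \<cdot> g)"
  using stable_class_Comp[OF assms rep_stable_class[OF assms(1)] rep_stable_class[OF assms(2)]]
  by (simp add: stable_category_def)

lemma stable_Ident: "Ident (stable_category E) X = stable_class E (Ident E X)"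
  and stable_Ob: "Ob (stable_category E) = Ob E"
  by (simp_all add: stable_category_def)

text \<open>The axioms descend from \<open>E\<close> through representatives. The result lets
  \<open>coretraction_imp_monomorphism\<close> be applied to the stable category.\<close>

lemma category_stable_category: "category (stable_category E)"
proof
  fix \<phi> assume "\<phi> \<in> Arr (stable_category E)"
  then have "\<phi> \<in> Hom (stable_category E) (Dom (stable_category E) \<phi>) (Cod (stable_category E) \<phi>)"
    by (simp add: Hom_def)
  then show "Dom (stable_category E) \<phi> \<in> Ob (stable_category E)"
    "Cod (stable_category E) \<phi> \<in> Ob (stable_category E)"
    by (auto elim!: stable_HomE simp: stable_Ob dest: Hom_in_Ob)
next
  fix X assume "X \<in> Ob (stable_category E)"
  then show "Ident (stable_category E) X \<in> Hom (stable_category E) X X"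
    by (simp add: stable_Ident stable_Ob Ident_in_Hom stable_class_in_stable_Hom)
next
  fix \<phi> \<psi> X Y Z
  assume "\<phi> \<in> Hom (stable_category E) X Y" "\<psi> \<in> Hom (stable_category E) Y Z"
  then show "\<phi> \<cdot>\<^bsub>stable_category E\<^esub> \<psi> \<in> Hom (stable_category E) X Z"
    by (auto elim!: stable_HomE simp: stable_Comp intro: stable_class_in_stable_Hom[OF Comp_in_Hom])
next
  fix \<phi> X Y assume "\<phi> \<in> Hom (stable_category E) X Y"
  then obtain f where f: "f \<in> Hom E X Y" "\<phi> = stable_class E f" by (rule stable_HomE)
  show "Ident (stable_category E) X \<cdot>\<^bsub>stable_category E\<^esub> \<phi> = \<phi>"
    "\<phi> \<cdot>\<^bsub>stable_category E\<^esub> Ident (stable_category E) Y = \<phi>"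
    using stable_Comp[OF Ident_in_Hom f(1)] stable_Comp[OF f(1) Ident_in_Hom] Ident_Comp[OF f(1)]
      Comp_Ident[OF f(1)] Hom_in_Ob[OF f(1)] f(2)
    by (simp_all add: stable_Ident)
next
  fix \<phi> \<psi> \<chi> W X Y Z
  assume "\<phi> \<in> Hom (stable_category E) W X" "\<psi> \<in> Hom (stable_category E) X Y"
    "\<chi> \<in> Hom (stable_category E) Y Z"
  then obtain f g h where H: "f \<in> Hom E W X" "g \<in> Hom E X Y" "h \<in> Hom E Y Z"
    and [simp]: "\<phi> = stable_class E f" "\<psi> = stable_class E g" "\<chi> = stable_class E h"
    by (metis stable_HomE)
  show "\<phi> \<cdot>\<^bsub>stable_category E\<^esub> \<psi> \<cdot>\<^bsub>stable_category E\<^esub> \<chi> =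
      \<phi> \<cdot>\<^bsub>stable_category E\<^esub> (\<psi> \<cdot>\<^bsub>stable_category E\<^esub> \<chi>)"
    using stable_Comp[OF H(1,2)] stable_Comp[OF H(2,3)] Comp_assoc[OF H]
      stable_Comp[OF Comp_in_Hom[OF H(1,2)] H(3)] stable_Comp[OF H(1) Comp_in_Hom[OF H(2,3)]]
    by simp
qed

section \<open>Stable zero morphisms, stable monomorphisms and the Heller operator\<close>

lemma stable_class_eq_Zero_iff:
  assumes f: "f \<in> Hom E X Y"
  shows "stable_class E f = stable_class E (Zero E X Y) \<longleftrightarrow> f \<in> null_homs E X Y"
proof -
  note Ob = Hom_in_Ob[OF f]
  have n: "n \<in> Hom E X Y \<and> Add E n (Zero E X Y) = n" if "n \<in> null_homs E X Y" for n
    using that subgroup.subset[OF subgroup_null_homs[OF Ob]]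
      monoid.r_one[OF group.is_monoid[OF group_hom_group[OF Ob]], of n] by auto
  have "stable_class E f = stable_class E (Zero E X Y) \<longleftrightarrow> f \<in> stable_class E (Zero E X Y)"
    using stable_class_eq[OF Zero_in_Hom[OF Ob]] stable_class_self[OF f] by blast
  also have "\<dots> \<longleftrightarrow> f \<in> null_homs E X Y"
    using n mem_stable_class_iff[OF Zero_in_Hom[OF Ob]] by fastforce
  finally show ?thesis .
qed

text \<open>The classes of \<open>g\<close> and of zero have the same composite with the class of
  \<open>f\<close>; cancelling the latter shows that the class of \<open>g\<close> is zero.\<close>

lemma null_homs_if_Comp_monomorphism:
  assumes f: "f \<in> Hom E X Y" and mono: "monomorphism (stable_category E) (stable_class E f)"
    and g: "g \<in> Hom E T X" and gf: "g \<cdot> f \<in> null_homs E T Y"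
  shows "g \<in> null_homs E T X"
proof -
  have Ob: "T \<in> Ob E" "X \<in> Ob E" "Y \<in> Ob E" using f g Hom_in_Ob by auto
  have "stable_class E g \<cdot>\<^bsub>stable_category E\<^esub> stable_class E f =
      stable_class E (Zero E T X) \<cdot>\<^bsub>stable_category E\<^esub> stable_class E f"
    using stable_Comp[OF g f] stable_Comp[OF Zero_in_Hom f] Zero_Comp[OF f] Ob gf
      stable_class_eq_Zero_iff[OF Comp_in_Hom[OF g f]]
    by simp
  moreover have "Dom (stable_category E) (stable_class E f) = X"
    using stable_class_in_stable_Hom[OF f] by (simp add: Hom_def)
  ultimately have "stable_class E g = stable_class E (Zero E T X)"
    using mono stable_class_in_stable_Hom[OF g]
      stable_class_in_stable_Hom[OF Zero_in_Hom[OF Ob(1,2)]]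
    unfolding monomorphism_def by blast
  then show ?thesis using stable_class_eq_Zero_iff[OF g] by simp
qed

text \<open>Relative projectivity lifts \<open>p X \<cdot> f\<close> along \<open>p Y\<close> to
  \<open>fh\<close>. Then \<open>i X \<cdot> fh\<close> is annihilated by \<open>p Y\<close> and
  factors through the kernel \<open>i Y\<close>. This ensures that the \<open>SOME\<close> in
  \<open>heller\<close> picks an actual lift.\<close>

lemma ex_heller_lift:
  assumes f: "f \<in> Hom E X Y"
  shows "\<exists>f' fh. heller_lift E i p f' fh f"
proof -
  note Ob = Hom_in_Ob[OF f]
  have pf: "p X \<cdot> f \<in> Hom E (Dom E (p X)) Y"
    using Comp_in_Hom[OF chosen_p[OF Ob(1)] f] .
  moreover have "Cod E (p Y) = Y" using chosen_p[OF Ob(2)] by (simp add: Hom_def)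
  ultimately obtain fh where fh: "fh \<in> Hom E (Dom E (p X)) (Dom E (p Y))" "fh \<cdot> p Y = p X \<cdot> f"
    using rel_projective_lift[OF chosen_rel_projective[OF Ob(1)] chosen_pure_epi[OF Ob(2)]] by metis
  have OmX: "Dom E (i X) \<in> Ob E" using chosen_i[OF Ob(1)] Hom_in_Ob by blast
  have "i X \<cdot> fh \<cdot> p Y = Zero E (Dom E (i X)) Y"
    using Comp_assoc[OF chosen_i[OF Ob(1)] fh(1) chosen_p[OF Ob(2)]] fh(2)
      Comp_assoc[OF chosen_i[OF Ob(1)] chosen_p[OF Ob(1)] f] chosen_i_p[OF Ob(1)]
      Zero_Comp[OF f OmX] by simp
  then obtain f' where "f' \<in> Hom E (Dom E (i X)) (Dom E (i Y))" "f' \<cdot> i Y = i X \<cdot> fh"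
    using kernel_factor[OF chosen_kernel[OF Ob(2)] Comp_in_Hom[OF chosen_i[OF Ob(1)] fh(1)]]
      \<open>Cod E (p Y) = Y\<close> by metis
  with fh f show ?thesis by (auto simp: heller_lift_def Let_def Hom_def)
qed

text \<open>Formulated for an arbitrary lift, so that it applies to whichever one
  \<open>heller\<close> selects.\<close>

lemma heller_lift_coretraction:
  assumes f: "f \<in> Hom E X Y" and mono: "monomorphism (stable_category E) (stable_class E f)"
    and lift: "heller_lift E i p f' fh f"
  obtains w where "w \<in> Hom E (Dom E (i Y)) (Dom E (i X))"
    "stable_class E (f' \<cdot> w) = stable_class E (Ident E (Dom E (i X)))"
proof -
  note Ob = Hom_in_Ob[OF f]
  note iX = chosen_i[OF Ob(1)] and pX = chosen_p[OF Ob(1)]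
  note iY = chosen_i[OF Ob(2)] and pY = chosen_p[OF Ob(2)]
  have Ob': "Dom E (i X) \<in> Ob E" "Dom E (i Y) \<in> Ob E" "Dom E (p X) \<in> Ob E"
    using Hom_in_Ob[OF iX] Hom_in_Ob[OF iY] by auto
  have f': "f' \<in> Hom E (Dom E (i X)) (Dom E (i Y))" "f' \<cdot> i Y = i X \<cdot> fh"
    and fh: "fh \<in> Hom E (Dom E (p X)) (Dom E (p Y))" "fh \<cdot> p Y = p X \<cdot> f"
    using lift f by (auto simp: heller_lift_def Let_def Hom_def)
  obtain b k where pb: "pullback_square E b k (p Y) f"
    using pure_epi_pullback[OF chosen_pure_epi[OF Ob(2)], of f] f pY by (auto simp: Hom_def)
  define K where "K = Dom E b"
  have b: "b \<in> Hom E K (Dom E (p Y))" and k: "k \<in> Hom E K X" and bk: "b \<cdot> p Y = k \<cdot> f"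
    using pb f pY by (auto simp: K_def pullback_square_def commutative_square_def Hom_def)
  have DomF: "Dom E f = X" using f by (simp add: Hom_def)
  \<comment> \<open>The test pair is \<open>i Y\<close> and zero, compatible because
    \<open>i Y \<cdot> p Y\<close> vanishes. Thus \<open>j\<close> embeds the kernel of
    \<open>p Y\<close> into the pullback.\<close>
  obtain j where j: "j \<in> Hom E (Dom E (i Y)) K" "j \<cdot> b = i Y" "j \<cdot> k = Zero E (Dom E (i Y)) X"
    using pullback_squareE[OF pb iY, of "Zero E (Dom E (i Y)) X"] chosen_i_p[OF Ob(2)]
      Zero_Comp[OF f Ob'(2)] Zero_in_Hom[OF Ob'(2) Ob(1)] DomF unfolding K_def by metis
  obtain u where u: "u \<in> Hom E (Dom E (p X)) K" "u \<cdot> b = fh" "u \<cdot> k = p X"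
    using pullback_squareE[OF pb fh(1), of "p X"] pX fh(2) DomF unfolding K_def by metis
  \<comment> \<open>Both sides are compared through the projections of the pullback:
    \<open>b\<close> turns each into \<open>i X \<cdot> fh\<close>, and \<open>k\<close> turns each
    into zero.\<close>
  have iu: "i X \<cdot> u = f' \<cdot> j"
  proof (rule pullback_square_unique[OF pb category_axioms])
    show "i X \<cdot> u \<in> Hom E (Dom E (i X)) (Dom E b)" "f' \<cdot> j \<in> Hom E (Dom E (i X)) (Dom E b)"
      using Comp_in_Hom[OF iX u(1)] Comp_in_Hom[OF f'(1) j(1)] by (simp_all add: K_def)
    show "i X \<cdot> u \<cdot> b = f' \<cdot> j \<cdot> b"
      using Comp_assoc[OF iX u(1) b] Comp_assoc[OF f'(1) j(1) b] u(2) j(2) f'(2) by simp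
    show "i X \<cdot> u \<cdot> k = f' \<cdot> j \<cdot> k"
      using Comp_assoc[OF iX u(1) k] Comp_assoc[OF f'(1) j(1) k] u(3) j(3)
        chosen_i_p[OF Ob(1)] Comp_Zero[OF f'(1) Ob(1)] by simp
  qed
  have "k \<cdot> f \<in> null_homs E K Y"
    using bk b null_homs_eq[OF Hom_in_Ob(1)[OF b] Ob(2)] by force
  then have "k \<in> null_homs E K X"
    by (rule null_homs_if_Comp_monomorphism[OF f mono k])
  \<comment> \<open>By \<open>null_homs_eq\<close> the factorization of \<open>k\<close> can be
    taken over the chosen \<open>p X\<close>, so that \<open>v\<close> can be composed with
    \<open>u\<close> to an endomorphism.\<close>
  then obtain v where v: "v \<in> Hom E K (Dom E (p X))" "v \<cdot> p X = k"
    using null_homs_eq[OF Hom_in_Ob(1)[OF b] Ob(1)] by auto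
  have CodpX: "Cod E (p X) = X" using pX by (simp add: Hom_def)
  \<comment> \<open>As \<open>v \<cdot> p X = k\<close> and \<open>j \<cdot> k\<close> is zero,
    \<open>v\<close> restricts along \<open>j\<close> to a morphism \<open>w\<close> of
    kernels.\<close>
  have "j \<cdot> v \<cdot> p X = Zero E (Dom E (i Y)) (Cod E (p X))"
    using Comp_assoc[OF j(1) v(1) pX] v(2) j(3) CodpX by simp
  then obtain w where w: "w \<in> Hom E (Dom E (i Y)) (Dom E (i X))" "w \<cdot> i X = j \<cdot> v"
    using kernel_factor[OF chosen_kernel[OF Ob(1)] Comp_in_Hom[OF j(1) v(1)]] by metis
  note Id = Ident_in_Hom[OF Ob'(1)] Ident_in_Hom[OF Ob'(3)]
  have "u \<cdot> v \<cdot> p X = Ident E (Dom E (p X)) \<cdot> p X"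
    using Comp_assoc[OF u(1) v(1) pX] u(3) v(2) Ident_Comp[OF pX] by simp
  then obtain s where s: "s \<in> Hom E (Dom E (p X)) (Dom E (i X))"
    "u \<cdot> v = Add E (s \<cdot> i X) (Ident E (Dom E (p X)))"
    using comp_eq_imp_eq_Add_kernel[OF chosen_kernel[OF Ob(1)] Comp_in_Hom[OF u(1) v(1)] Id(2)]
    by metis
  note iXs = Comp_in_Hom[OF iX s(1)]
  \<comment> \<open>The equation \<open>f' \<cdot> w = i X \<cdot> s + 1\<close> is checked after
    composition with \<open>i X\<close>, which is then cancelled as a kernel.\<close>
  have "f' \<cdot> w \<cdot> i X = f' \<cdot> j \<cdot> v"
    using Comp_assoc[OF f'(1) w(1) iX] w(2) Comp_assoc[OF f'(1) j(1) v(1)] by simp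
  also have "\<dots> = i X \<cdot> (u \<cdot> v)"
    using Comp_assoc[OF iX u(1) v(1)] iu by simp
  also have "\<dots> = Add E (i X \<cdot> s \<cdot> i X) (Ident E (Dom E (i X)) \<cdot> i X)"
    using Comp_Add_right[OF iX Comp_in_Hom[OF s(1) iX] Id(2)] s(2) Comp_assoc[OF iX s(1) iX]
      Ident_Comp[OF iX] Comp_Ident[OF iX] by simp
  also have "\<dots> = Add E (i X \<cdot> s) (Ident E (Dom E (i X))) \<cdot> i X"
    using Comp_Add_left[OF iXs Id(1) iX] by simp
  finally have "f' \<cdot> w = Add E (i X \<cdot> s) (Ident E (Dom E (i X)))"
    by (rule kernel_cancel[OF chosen_kernel[OF Ob(1)] Comp_in_Hom[OF f'(1) w(1)]
          Add_in_Hom[OF iXs Id(1)]])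
  \<comment> \<open>The correction term passes through the relatively projective object
    \<open>Dom E (p X)\<close>.\<close>
  moreover have "i X \<cdot> s \<in> null_homs E (Dom E (i X)) (Dom E (i X))"
    using iX s(1) chosen_rel_projective[OF Ob(1)] by (auto simp: null_homs_def)
  ultimately have "f' \<cdot> w \<in> stable_class E (Ident E (Dom E (i X)))"
    using mem_stable_class_iff[OF Id(1)] by blast
  with stable_class_eq[OF Id(1)] w(1) that show thesis by blast
qed

lemma heller_coretraction:
  assumes mono: "monomorphism (stable_category E) \<phi>"
  shows "coretraction (stable_category E) (heller E i p \<phi>)"
proof -
  let ?S = "stable_category E"
  have "\<phi> \<in> Hom ?S (Dom ?S \<phi>) (Cod ?S \<phi>)"
    using mono by (simp add: monomorphism_def Hom_def)
  then obtain f0 where f0: "f0 \<in> Hom E (Dom ?S \<phi>) (Cod ?S \<phi>)" "\<phi> = stable_class E f0"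
    by (rule stable_HomE)
  \<comment> \<open>The representative has to be \<open>rep \<phi>\<close>, since that is the one
    \<open>heller\<close> lifts; \<open>f0\<close> serves to show that it has the right ends and
    class.\<close>
  define X Y f where "X = Dom ?S \<phi>" and "Y = Cod ?S \<phi>" and "f = rep \<phi>"
  have f: "f \<in> Hom E X Y" and \<phi>: "stable_class E f = \<phi>"
    using rep_stable_class[OF f0(1)] stable_class_in_Hom[OF f0(1)] stable_class_eq[OF f0(1)] f0(2)
    by (simp_all add: X_def Y_def f_def)
  define f' where "f' = (SOME f'. \<exists>fh. heller_lift E i p f' fh f)"
  have h: "heller E i p \<phi> = stable_class E f'" by (simp add: heller_def f'_def f_def)
  obtain fh where lift: "heller_lift E i p f' fh f"
    using someI_ex[OF ex_heller_lift[OF f]] by (auto simp: f'_def)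
  then have f': "f' \<in> Hom E (Dom E (i X)) (Dom E (i Y))"
    using f by (auto simp: heller_lift_def Let_def Hom_def)
  obtain w where w: "w \<in> Hom E (Dom E (i Y)) (Dom E (i X))"
    "stable_class E (f' \<cdot> w) = stable_class E (Ident E (Dom E (i X)))"
    using heller_lift_coretraction[OF f _ lift] mono \<phi> by auto
  have "stable_class E f' \<in> Hom ?S (Dom E (i X)) (Dom E (i Y))"
    "stable_class E w \<in> Hom ?S (Dom E (i Y)) (Dom E (i X))"
    "stable_class E f' \<cdot>\<^bsub>?S\<^esub> stable_class E w = Ident ?S (Dom E (i X))"
    using stable_class_in_stable_Hom f' w stable_Comp[OF f' w(1)] by (auto simp: stable_Ident)
  then show ?thesis unfolding h coretraction_def by (auto simp: Hom_def)
qed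

end

theorem proposition4:
  fixes E :: "('o, 'm) excat" and i p :: "'o \<Rightarrow> 'm"
  assumes "exact_category E"
    and "weakly_idempotent_complete E"
    and "has_rel_projective_covers E"
    and "heller_choice E i p"
  shows "(\<forall>\<phi>. monomorphism (stable_category E) \<phi> \<longrightarrow>
              coretraction (stable_category E) (heller E i p \<phi>)) \<and>
         (\<forall>\<phi>. monomorphism (stable_category E) \<phi> \<longrightarrow>
              monomorphism (stable_category E) (heller E i p \<phi>))"
proof -
  interpret exact_category_heller E i p
    using assms by (simp add: exact_category_heller_def exact_category_heller_axioms_def)
  show ?thesis
    using heller_coretraction category.coretraction_imp_monomorphism[OF category_stable_category]
    by blast
qed

end
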